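(* Let $G=(V,E)$ be a finite connected loopless graph. Then: (i) For each $\beta\in F_\mathbb{Z}$, the map $d^*$ restricts to a linear projection from $\square_\beta$ onto the Voronoi cell $\mathrm{Vor}_\Delta(d^*(\beta))$, and $d^*$ maps the interior of $\square_\beta$ onto the interior of $\mathrm{Vor}_\Delta(d^*(\beta))$. (ii) For each $\beta\in F_\mathbb{Z}$, $(d^* )^{-1}(\mathrm{Vor}_\Delta(d^*(\beta)))\cap\square_{F_\mathbb{Z}}=\square_\beta$. (iii) All the fibers of $d^*\colon\square_{F_\mathbb{Z}}\to\Lambda_\mathbb{R}$ are compact and contractible; in particular $\square_{F_\mathbb{Z}}$ is contractible. (iv) The dual complexes of $\square_{F_\mathbb{Z}}$ and of the Voronoi decomposition $\{\mathrm{Vor}_\Delta(\lambda)\}_{\lambda\in\Lambda_\mathbb{Z}}$ are isomorphic.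
   Context: $\mathbb{E}$: oriented edges of $G$ ($e=uv$, tail $u$, head $v$, reverse $\bar e$). $C^0(G,A)$ = functions $V\to A$; $C^1(G,A)$ = functions $x\colon\mathbb{E}\to A$ with $x_{\bar e}=-x_e$. $d(f)(uv)=f(v)-f(u)$; $d^*\colon C^1(G,\mathbb{R})\to C^0(G,\mathbb{R})$, $d^*(x)(v)=\sum_{e\in\mathbb{E},\ \mathrm{head}(e)=v}x_e$ (the adjoint of $d$ for the inner products $\langle f,g\rangle=\sum_vf(v)g(v)$ and $\langle x,y\rangle=\sum_{e\in E}x_ey_e$, each edge counted once). $F_A=d(C^0(G,A))$, $\Lambda_A=d^*(F_A)$; $H_{0,\mathbb{R}}=\{f\in C^0(G,\mathbb{R}):\sum_vf(v)=0\}=\Lambda_\mathbb{R}$. $\Delta=d^*d$ is the Laplacian, and $q$ is the quadratic form on $H_{0,\mathbb{R}}$ given by $q(h)=\langle f,\Delta f\rangle$ for any $f$ with $\Delta f=h$. For $\lambda\in\Lambda_\mathbb{Z}$, $\mathrm{Vor}_\Delta(\lambda)=\{x\in H_{0,\mathbb{R}}:q(x-\lambda)\le q(x-\mu)\ \forall\mu\in\Lambda_\mathbb{Z}\}$. For $\beta\in C^1(G,\mathbb{Z})$, $\square_\beta=\{x\in C^1(G,\mathbb{R}):\max_{e}|x_e-\beta_e|\le\frac12\}$, and $\square_{F_\mathbb{Z}}=\bigcup_{\beta\in F_\mathbb{Z}}\square_\beta$. The dual complex of $\square_{F_\mathbb{Z}}$ is the simplicial complex with vertex set $F_\mathbb{Z}$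 whose simplices are the finite subsets $S$ with $\bigcap_{\beta\in S}\square_\beta\neq\emptyset$; that of the Voronoi decomposition has vertex set $\Lambda_\mathbb{Z}$ and simplices the finite $S$ with $\bigcap_{\lambda\in S}\mathrm{Vor}_\Delta(\lambda)\ne\emptyset$. *)

theory Defs
  imports "HOL-Analysis.Analysis" "Graph_Theory.Graph_Theory"
begin

text \<open>
  A graph (parallel edges allowed) is given by its oriented edges: \<open>arcs G\<close> is the set of
  oriented edges and the fixed-point-free involution \<open>arev\<close> of \<^locale>\<open>bidirected_digraph\<close> sends
  an oriented edge to its reverse. Vertices and oriented edges are subsets of finite types, so that
  the cochain spaces are subspaces of Euclidean spaces; cochains are extended by 0 outside
  \<open>verts G\<close> and \<open>arcs G\<close>. In particular \<open>arcs G\<close> may be empty. Cochains with values in the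
  subgroup \<open>A\<close> of the reals are obtained with \<open>A = \<int>\<close> and \<open>A = UNIV\<close>.
\<close>

definition C0 :: "('v::finite, 'e::finite) pre_digraph \<Rightarrow> real set \<Rightarrow> (real ^ 'v) set" where
  "C0 G A = {f. (\<forall>v \<in> verts G. f $ v \<in> A) \<and> (\<forall>v. v \<notin> verts G \<longrightarrow> f $ v = 0)}"

definition C1 :: "('v::finite, 'e::finite) pre_digraph \<Rightarrow> ('e \<Rightarrow> 'e) \<Rightarrow> real set \<Rightarrow> (real ^ 'e) set"
  where
  "C1 G arev A = {x. (\<forall>e \<in> arcs G. x $ e \<in> A \<and> x $ arev e = - x $ e) \<and>
                     (\<forall>e. e \<notin> arcs G \<longrightarrow> x $ e = 0)}"

definition cobd :: "('v::finite, 'e::finite) pre_digraph \<Rightarrow> real ^ 'v \<Rightarrow> real ^ 'e" where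
  "cobd G f = (\<chi> e. if e \<in> arcs G then f $ head G e - f $ tail G e else 0)"

definition cobd_adj :: "('v::finite, 'e::finite) pre_digraph \<Rightarrow> real ^ 'e \<Rightarrow> real ^ 'v" where
  "cobd_adj G x = (\<chi> v. \<Sum>e \<in> {e \<in> arcs G. head G e = v}. x $ e)"

definition Flat :: "('v::finite, 'e::finite) pre_digraph \<Rightarrow> real set \<Rightarrow> (real ^ 'e) set" where
  "Flat G A = cobd G ` C0 G A"

definition Lam :: "('v::finite, 'e::finite) pre_digraph \<Rightarrow> real set \<Rightarrow> (real ^ 'v) set" where
  "Lam G A = cobd_adj G ` Flat G A"

definition H0 :: "('v::finite, 'e::finite) pre_digraph \<Rightarrow> (real ^ 'v) set" where
  "H0 G = {f \<in> C0 G UNIV. (\<Sum>v \<in> verts G. f $ v) = 0}"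

definition lapl :: "('v::finite, 'e::finite) pre_digraph \<Rightarrow> real ^ 'v \<Rightarrow> real ^ 'v" where
  "lapl G f = cobd_adj G (cobd G f)"

text \<open>The value does not depend on the choice of \<open>f\<close>; see \<open>qform_lapl\<close> below.\<close>

definition qform :: "('v::finite, 'e::finite) pre_digraph \<Rightarrow> real ^ 'v \<Rightarrow> real" where
  "qform G h = (THE r. \<exists>f \<in> C0 G UNIV. lapl G f = h \<and> r = f \<bullet> lapl G f)"

definition Vor :: "('v::finite, 'e::finite) pre_digraph \<Rightarrow> real ^ 'v \<Rightarrow> (real ^ 'v) set" where
  "Vor G l = {x \<in> H0 G. \<forall>m \<in> Lam G \<int>. qform G (x - l) \<le> qform G (x - m)}"

definition cube :: "('v::finite, 'e::finite) pre_digraph \<Rightarrow> ('e \<Rightarrow> 'e) \<Rightarrow> real ^ 'e \<Rightarrow> (real ^ 'e) set"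
  where
  "cube G arev b = {x \<in> C1 G arev UNIV. \<forall>e \<in> arcs G. \<bar>x $ e - b $ e\<bar> \<le> 1 / 2}"

definition cubes :: "('v::finite, 'e::finite) pre_digraph \<Rightarrow> ('e \<Rightarrow> 'e) \<Rightarrow> (real ^ 'e) set" where
  "cubes G arev = (\<Union>b \<in> Flat G \<int>. cube G arev b)"

text \<open>An abstract simplicial complex is given by its vertex set and its set of simplices.\<close>

definition dual_complex :: "'i set \<Rightarrow> ('i \<Rightarrow> 'a set) \<Rightarrow> 'i set set" where
  "dual_complex I cell = {S. finite S \<and> S \<subseteq> I \<and> (\<Inter>i \<in> S. cell i) \<noteq> {}}"

definition complex_isomorphic :: "'i set \<Rightarrow> 'i set set \<Rightarrow> 'j set \<Rightarrow> 'j set set \<Rightarrow> bool" where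
  "complex_isomorphic V K W L \<longleftrightarrow>
     (\<exists>\<phi>. bij_betw \<phi> V W \<and> (\<forall>S. S \<subseteq> V \<longrightarrow> (S \<in> K \<longleftrightarrow> \<phi> ` S \<in> L)))"

lemma linear_cobd: "linear (cobd G)"
  by (rule linearI) (auto simp: cobd_def vec_eq_iff algebra_simps)

lemma linear_cobd_adj: "linear (cobd_adj G)"
  by (rule linearI) (auto simp: cobd_adj_def vec_eq_iff sum.distrib sum_distrib_left)

lemma linear_lapl: "linear (lapl G)"
  using linear_compose[OF linear_cobd linear_cobd_adj] by (simp add: lapl_def[abs_def] o_def)

lemma subspace_C0: "subspace (C0 G UNIV)"
  by (auto simp: subspace_def C0_def)

lemma subspace_H0: "subspace (H0 G)"
  by (auto simp: subspace_def H0_def C0_def sum.distrib simp flip: sum_distrib_left)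

text \<open>
  The right-hand side is the inner product on 1-cochains that counts each edge once: the sum over
  oriented edges counts it twice.
\<close>

lemma cobd_adjoint:
  fixes G :: "('v::finite, 'e::finite) pre_digraph"
  assumes "bidirected_digraph G arev" and x: "x \<in> C1 G arev UNIV"
  shows "f \<bullet> cobd_adj G x = (\<Sum>e \<in> arcs G. cobd G f $ e * x $ e) / 2"
proof -
  interpret bidirected_digraph G arev by fact
  have "f \<bullet> cobd_adj G x = (\<Sum>v \<in> UNIV. \<Sum>e \<in> {e \<in> arcs G. head G e = v}. f $ head G e * x $ e)"
    by (auto simp: inner_vec_def cobd_adj_def sum_distrib_left intro!: sum.cong)
  also have "\<dots> = (\<Sum>e \<in> arcs G. f $ head G e * x $ e)"
    by (rule sum.group) auto
  finally have 1: "f \<bullet> cobd_adj G x = (\<Sum>e \<in> arcs G. f $ head G e * x $ e)" .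
  also have "\<dots> = (\<Sum>e \<in> arcs G. f $ head G (arev e) * x $ arev e)"
    using sum.permute[OF arev_permutes_arcs, of "\<lambda>e. f $ head G e * x $ e"] by (simp add: o_def)
  also have "\<dots> = - (\<Sum>e \<in> arcs G. f $ tail G e * x $ e)"
    using x by (auto simp: C1_def sum_negf[symmetric] intro!: sum.cong)
  finally have 2: "f \<bullet> cobd_adj G x = - (\<Sum>e \<in> arcs G. f $ tail G e * x $ e)" .
  have "(\<Sum>e \<in> arcs G. cobd G f $ e * x $ e) =
      (\<Sum>e \<in> arcs G. f $ head G e * x $ e) - (\<Sum>e \<in> arcs G. f $ tail G e * x $ e)"
    by (auto simp: cobd_def sum_subtractf[symmetric] algebra_simps intro!: sum.cong)
  with 1 2 show ?thesis by simp
qed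

lemma cobd_in_C1:
  assumes "bidirected_digraph G arev"
  shows "cobd G f \<in> C1 G arev UNIV"
proof -
  interpret bidirected_digraph G arev by fact
  show ?thesis by (auto simp: C1_def cobd_def)
qed

lemma inner_lapl:
  assumes "bidirected_digraph G arev"
  shows "f \<bullet> lapl G g = (\<Sum>e \<in> arcs G. cobd G f $ e * cobd G g $ e) / 2"
  unfolding lapl_def by (rule cobd_adjoint[OF assms cobd_in_C1[OF assms]])

lemma qform_lapl:
  assumes "bidirected_digraph G arev" and "f \<in> C0 G UNIV"
  shows "qform G (lapl G f) = f \<bullet> lapl G f"
  unfolding qform_def
proof (rule the_equality)
  show "\<exists>f'\<in>C0 G UNIV. lapl G f' = lapl G f \<and> f \<bullet> lapl G f = f' \<bullet> lapl G f'"
    using assms by blast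
next
  fix r assume "\<exists>g\<in>C0 G UNIV. lapl G g = lapl G f \<and> r = g \<bullet> lapl G g"
  then obtain g where g: "lapl G g = lapl G f" "r = g \<bullet> lapl G g" by blast
  have "g \<bullet> lapl G f = f \<bullet> lapl G g"
    unfolding inner_lapl[OF assms(1)] by (simp add: mult.commute)
  with g show "r = f \<bullet> lapl G f" by simp
qed

lemma H0_eq_Lam:
  fixes G :: "('v::finite, 'e::finite) pre_digraph"
  assumes "bidirected_digraph G arev" and con: "Digraph_Component.connected G"
  shows "H0 G = Lam G UNIV"
proof -
  interpret bidirected_digraph G arev by fact
  have lam: "Lam G UNIV = lapl G ` C0 G UNIV"
    by (simp add: Lam_def Flat_def image_image lapl_def)
  have sub: "lapl G f \<in> H0 G" for f
  proof -
    have "(\<chi> v. 1) \<bullet> lapl G f = 0"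
      unfolding inner_lapl[OF assms(1)] by (simp add: cobd_def)
    moreover have C: "lapl G f \<in> C0 G UNIV"
      by (auto simp: C0_def lapl_def cobd_adj_def intro!: sum.neutral)
    moreover have "(\<Sum>v \<in> verts G. lapl G f $ v) = (\<Sum>v \<in> UNIV. lapl G f $ v)"
      using C by (intro sum.mono_neutral_left) (auto simp: C0_def)
    ultimately show ?thesis by (simp add: H0_def inner_vec_def)
  qed
  have zero: "f = 0" if f: "f \<in> H0 G" and l: "lapl G f = 0" for f
  proof -
    have "(\<Sum>e \<in> arcs G. cobd G f $ e * cobd G f $ e) = 0"
      using inner_lapl[OF assms(1), of f f] l by simp
    then have "\<forall>e \<in> arcs G. cobd G f $ e * cobd G f $ e = 0"
      by (subst (asm) sum_nonneg_eq_0_iff) auto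
    then have arc: "f $ head G e = f $ tail G e" if "e \<in> arcs G" for e
      using that by (simp add: cobd_def)
    have const: "f $ u = f $ v" if "u \<in> verts G" "v \<in> verts G" for u v
    proof -
      have "(u, v) \<in> rtrancl_on (verts G) ((arcs_ends G)\<^sup>s)"
        using con that unfolding connected_conv by blast
      then show ?thesis
      proof (induction rule: rtrancl_on_induct)
        case (step v w)
        from step.hyps obtain e where "e \<in> arcs G"
          "(v = tail G e \<and> w = head G e) \<or> (v = head G e \<and> w = tail G e)"
          by (auto simp: arcs_ends_conv symcl_def)
        then show ?case using arc[of e] step.IH by auto
      qed simp
    qed
    obtain u where u: "u \<in> verts G" using con unfolding connected_conv by blast
    have "(\<Sum>v \<in> verts G. f $ v) = real (card (verts G)) * f $ u"
      using sum.cong[OF refl const[OF _ u], of "verts G"] by simp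
    with f u have "f $ u = 0" by (auto simp: H0_def)
    have "f $ v = 0" for v
    proof (cases "v \<in> verts G")
      case True
      then show ?thesis using const[OF True u] \<open>f $ u = 0\<close> by simp
    next
      case False
      then show ?thesis using f by (simp add: H0_def C0_def)
    qed
    then show "f = 0" by (simp add: vec_eq_iff)
  qed
  have inj: "inj_on (lapl G) (H0 G)"
    using linear_injective_on_subspace_0[OF linear_lapl subspace_H0] zero by blast
  have "lapl G ` H0 G = H0 G"
  proof (rule subspace_dim_equal)
    show "subspace (lapl G ` H0 G)" by (rule linear_subspace_image[OF linear_lapl subspace_H0])
    have "dim (lapl G ` H0 G) = dim (H0 G)"
      using inj by (intro dim_image_eq[OF linear_lapl]) (simp add: span_eq_iff[THEN iffD2, OF subspace_H0])
    then show "dim (H0 G) \<le> dim (lapl G ` H0 G)" by simp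
  qed (use sub subspace_H0 in auto)
  moreover have "H0 G \<subseteq> C0 G UNIV" by (auto simp: H0_def)
  ultimately show ?thesis unfolding lam using sub by blast
qed

end

theory Submission
  imports Defs
begin

text \<open>
  Write \<open>\<beta> = d f\<close> with \<open>f\<close> integral. Expanding the quadratic form, \<open>h\<close> lies in the Voronoi cell of
  \<open>d\<^sup>* \<beta>\<close> iff \<open>2 \<langle>\<phi>, h - d\<^sup>* \<beta>\<rangle> \<le> |d \<phi>|\<^sup>2\<close> for all integral \<open>\<phi>\<close>. If \<open>h = d\<^sup>* x\<close> with \<open>x\<close> in the cube of
  \<open>\<beta>\<close>, this holds edge by edge because \<open>|n| \<le> n\<^sup>2\<close> for integers \<open>n\<close>; the equality case of the same
  estimate shows that a point of a cube that is mapped into another Voronoi cell lies in the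
  corresponding cube. Conversely, a point of the cell outside the image of the cube is separated from
  it by a function \<open>f\<close>, and decomposing \<open>f\<close> into indicators of its level sets produces a cut that
  violates the Voronoi inequality.

  A fiber over a point of a Voronoi cell is therefore a slice of a single cube, hence compact and
  convex. A linear map is open from a polytope onto its image, because the image is locally a cone;
  so the element of least norm of the fiber depends continuously on the base point. This gives a
  continuous section, and the cubes retract linearly along the fibers onto it.
\<close>

section \<open>Linear images of polytopes\<close>

text \<open>One half-space at a time: if \<open>h\<close> lies on the bounding hyperplane, the
  half-space is a cone with apex \<open>h\<close> and is preserved by every dilation about
  \<open>h\<close>; if \<open>h\<close> lies strictly inside, continuity suffices. Finitely many
  such neighbourhoods intersect in a neighbourhood.\<close>

lemma polyhedron_locally_conic:
  fixes Q :: "'a::euclidean_space set"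
  assumes Q: "polyhedron Q" and h: "h \<in> Q" and t: "0 < t"
  shows "eventually (\<lambda>h'. h' \<in> Q \<longrightarrow> h + (h' - h) /\<^sub>R t \<in> Q) (nhds h)"
proof -
  obtain F where F: "finite F" "Q = \<Inter>F"
    and half: "\<And>H. H \<in> F \<Longrightarrow> \<exists>a b. a \<noteq> 0 \<and> H = {x. a \<bullet> x \<le> b}"
    using Q unfolding polyhedron_def by metis
  have "eventually (\<lambda>h'. h' \<in> H \<longrightarrow> h + (h' - h) /\<^sub>R t \<in> H) (nhds h)" if HF: "H \<in> F" for H
  proof -
    obtain a b where H: "H = {x. a \<bullet> x \<le> b}" using half[OF HF] by blast
    have "a \<bullet> h \<le> b" using h F HF H by auto
    then consider "a \<bullet> h = b" | "a \<bullet> h < b" by linarith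
    then show ?thesis
    proof cases
      case 1
      have "a \<bullet> (h + (h' - h) /\<^sub>R t) \<le> b" if "a \<bullet> h' \<le> b" for h'
      proof -
        have "a \<bullet> (h + (h' - h) /\<^sub>R t) = b + (a \<bullet> h' - b) / t"
          using 1 by (simp add: inner_add_right inner_diff_right divide_inverse mult.commute)
        also have "\<dots> \<le> b" using that t by (simp add: divide_nonpos_pos)
        finally show ?thesis .
      qed
      then show ?thesis by (simp add: H)
    next
      case 2
      have "((\<lambda>h'. a \<bullet> (h + (h' - h) /\<^sub>R t)) \<longlongrightarrow> a \<bullet> (h + (h - h) /\<^sub>R t)) (nhds h)"
        by (intro tendsto_intros filterlim_ident)
      then have "eventually (\<lambda>h'. a \<bullet> (h + (h' - h) /\<^sub>R t) < b) (nhds h)"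
        using 2 by (intro order_tendstoD) auto
      then show ?thesis by eventually_elim (simp add: H)
    qed
  qed
  then have "eventually (\<lambda>h'. \<forall>H\<in>F. h' \<in> H \<longrightarrow> h + (h' - h) /\<^sub>R t \<in> H) (nhds h)"
    using F(1) by (simp add: eventually_ball_finite)
  then show ?thesis by eventually_elim (auto simp: F(2))
qed

lemma linear_image_polytope_lift:
  fixes P :: "'a::euclidean_space set" and L :: "'a \<Rightarrow> 'b::euclidean_space"
  assumes P: "polytope P" and L: "linear L" and x: "x \<in> P" and e: "0 < e"
  shows "eventually (\<lambda>h'. h' \<in> L ` P \<longrightarrow> (\<exists>x'\<in>P. L x' = h' \<and> dist x' x < e)) (nhds (L x))"
proof -
  obtain M where M: "0 < M" "\<And>y. y \<in> P \<Longrightarrow> norm y \<le> M"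
    using polytope_imp_bounded[OF P] unfolding bounded_pos by blast
  \<comment> \<open>\<open>2 * M\<close> bounds the distance between points of \<open>P\<close>, so
    a step of fraction \<open>t\<close> is shorter than \<open>e\<close>; the cap 1 keeps it a
    convex combination.\<close>
  define t where "t = min 1 (e / (4 * M))"
  have t: "0 < t" "t \<le> 1" "t * (2 * M) < e"
  proof -
    show "0 < t" "t \<le> 1" using e M by (auto simp: t_def)
    have "t * (2 * M) \<le> e / (4 * M) * (2 * M)"
      using M by (intro mult_right_mono) (auto simp: t_def)
    also have "\<dots> < e" using M e by simp
    finally show "t * (2 * M) < e" .
  qed
  have "polyhedron (L ` P)"
    using P L by (simp add: polytope_imp_polyhedron polytope_linear_image)
  then have "eventually (\<lambda>h'. h' \<in> L ` P \<longrightarrow> L x + (h' - L x) /\<^sub>R t \<in> L ` P) (nhds (L x))"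
    using x t by (intro polyhedron_locally_conic) auto
  then show ?thesis
  proof eventually_elim
    case (elim h')
    show ?case
    proof
      assume "h' \<in> L ` P"
      then obtain y where y: "y \<in> P" "L y = L x + (h' - L x) /\<^sub>R t" using elim by force
      define x' where "x' = (1 - t) *\<^sub>R x + t *\<^sub>R y"
      have "x' \<in> P"
        unfolding x'_def using polytope_imp_convex[OF P] x y t by (intro convexD_alt) auto
      moreover have "L x' = h'"
      proof -
        have "L x' = (1 - t) *\<^sub>R L x + t *\<^sub>R (L x + (h' - L x) /\<^sub>R t)"
          by (simp only: x'_def linear_add[OF L] linear_scale[OF L] y(2))
        also have "\<dots> = h'" using t by (simp add: algebra_simps)
        finally show ?thesis .
      qed
      moreover have "dist x' x < e"
      proof -
        have "dist x' x = t * norm (y - x)"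
          using t by (simp add: x'_def dist_norm algebra_simps flip: scaleR_diff_right)
        also have "\<dots> \<le> t * (2 * M)"
          using norm_triangle_ineq4[of y x] M(2)[OF x] M(2)[OF y(1)] t
          by (intro mult_left_mono) auto
        finally show ?thesis using t by simp
      qed
      ultimately show "\<exists>x'\<in>P. L x' = h' \<and> dist x' x < e" by blast
    qed
  qed
qed

lemma convex_linear_fiber:
  assumes "convex P" and L: "linear L"
  shows "convex {x \<in> P. L x = h}"
  using assms(1)
  by (auto simp: convex_alt linear_add[OF L] linear_scale[OF L] simp flip: scaleR_add_left)

lemma compact_linear_fiber:
  fixes L :: "'a::euclidean_space \<Rightarrow> 'b::euclidean_space"
  assumes "compact P" and L: "linear L"
  shows "compact {x \<in> P. L x = h}"
proof -
  have "closed {x. L x = h}"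
    using linear_continuous_on[of L UNIV] L
    by (intro closed_Collect_eq continuous_intros) (simp add: linear_conv_bounded_linear)
  then have "compact (P \<inter> {x. L x = h})" using assms(1) by (simp add: compact_Int_closed)
  then show ?thesis by (simp add: Collect_conj_eq)
qed

text \<open>Since \<open>P\<close> is compact, it is enough that the graph is closed. A limit of
  closest points lies in the limit fiber, and it is closest there because every competitor is a
  limit of points of the neighbouring fibers. Convexity makes the closest point unique.\<close>

lemma continuous_on_closest_point_fiber:
  fixes P :: "'a::euclidean_space set" and L :: "'a \<Rightarrow> 'b::euclidean_space"
  assumes P: "polytope P" and L: "linear L"
  shows "continuous_on (L ` P) (\<lambda>h. closest_point {x \<in> P. L x = h} a)"
proof -
  define Fib where "Fib h = {x \<in> P. L x = h}" for h
  define s where "s h = closest_point (Fib h) a" for h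
  have cP: "compact P" using P by (rule polytope_imp_compact)
  have convex: "convex (Fib h)" for h
    unfolding Fib_def by (rule convex_linear_fiber[OF polytope_imp_convex[OF P] L])
  have closed: "closed (Fib h)" for h
    unfolding Fib_def by (rule compact_imp_closed[OF compact_linear_fiber[OF cP L]])
  have s_in: "s h \<in> Fib h" if "h \<in> L ` P" for h
    unfolding s_def using that closed by (intro closest_point_in_set) (auto simp: Fib_def)
  have "continuous_on (L ` P) s"
  proof (rule continuous_from_closed_graph[OF cP])
    show "s \<in> L ` P \<rightarrow> P" using s_in by (auto simp: Fib_def)
    show "closed ((\<lambda>h. (h, s h)) ` (L ` P))"
    proof (rule closed_sequential_limits[THEN iffD2], intro allI impI, elim conjE)
      fix X l assume X: "\<forall>n. X n \<in> (\<lambda>h. (h, s h)) ` (L ` P)" and lim: "X \<longlonglongrightarrow> l"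
      define u where "u n = fst (X n)" for n
      have u: "u n \<in> L ` P" "X n = (u n, s (u n))" for n
        using X[rule_format, of n] by (auto simp: u_def)
      define h x where "h = fst l" and "x = snd l"
      have uh: "u \<longlonglongrightarrow> h" using tendsto_fst[OF lim] by (simp add: u_def[abs_def] h_def)
      have sx: "(\<lambda>n. s (u n)) \<longlonglongrightarrow> x" using tendsto_snd[OF lim] by (simp add: u(2) x_def)
      have "x \<in> P"
        using s_in[OF u(1)] by (intro closed_sequentially[OF compact_imp_closed[OF cP] _ sx])
          (simp add: Fib_def)
      have "(\<lambda>n. L (s (u n))) \<longlonglongrightarrow> L x"
        using bounded_linear.tendsto[OF linear_conv_bounded_linear[THEN iffD1, OF L] sx] .
      then have "u \<longlonglongrightarrow> L x" using s_in[OF u(1)] by (simp add: Fib_def)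
      then have Lx: "L x = h" using uh LIMSEQ_unique by blast
      then have h: "h \<in> L ` P" using \<open>x \<in> P\<close> by blast
      have xF: "x \<in> Fib h" using Lx \<open>x \<in> P\<close> by (simp add: Fib_def)
      have "dist a x \<le> dist a y" if y: "y \<in> Fib h" for y
      \<comment> \<open>The competitor \<open>y\<close> lies over \<open>h\<close> and not over
        \<open>u n\<close>, so it is replaced by a point over \<open>u n\<close> at distance less
        than \<open>e\<close>.\<close>
      proof (rule field_le_epsilon)
        fix e :: real assume e: "0 < e"
        have "y \<in> P" "L y = h" using y by (auto simp: Fib_def)
        have "eventually (\<lambda>n. u n \<in> L ` P \<longrightarrow> (\<exists>x'\<in>P. L x' = u n \<and> dist x' y < e)) sequentially"
          using eventually_compose_filterlim[OF linear_image_polytope_lift[OF P L \<open>y \<in> P\<close> e]] uh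
          by (simp add: \<open>L y = h\<close>)
        then have "eventually (\<lambda>n. dist a (s (u n)) \<le> dist a y + e) sequentially"
        proof eventually_elim
          case (elim n)
          then obtain x' where x': "x' \<in> P" "L x' = u n" "dist x' y < e" using u by blast
          have "dist a (s (u n)) \<le> dist a x'"
            unfolding s_def using x' by (intro closest_point_le closed) (simp add: Fib_def)
          also have "\<dots> \<le> dist a y + dist x' y" by (metis dist_commute dist_triangle)
          finally show ?case using x'(3) by simp
        qed
        then show "dist a x \<le> dist a y + e"
          using tendsto_dist[OF tendsto_const sx] by (intro tendsto_upperbound) auto
      qed
      then have "x = s h"
        unfolding s_def using closest_point_unique[OF convex closed xF] by blast
      then show "l \<in> (\<lambda>h. (h, s h)) ` (L ` P)"
        using h by (auto simp: h_def x_def intro!: image_eqI[of _ _ h] prod_eqI)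
    qed
  qed
  then show ?thesis by (simp add: s_def[abs_def] Fib_def)
qed

section \<open>Cubes and Voronoi cells\<close>

lemma cobd_diff: "cobd G (f - g) = cobd G f - cobd G g"
  by (rule linear_diff[OF linear_cobd])

lemma cobd_adj_diff: "cobd_adj G (x - y) = cobd_adj G x - cobd_adj G y"
  by (rule linear_diff[OF linear_cobd_adj])

lemma lapl_diff: "lapl G (f - g) = lapl G f - lapl G g"
  by (rule linear_diff[OF linear_lapl])

lemma C0_mono: "A \<subseteq> B \<Longrightarrow> C0 G A \<subseteq> C0 G B"
  by (auto simp: C0_def)

lemma C0_Ints_diff: "f \<in> C0 G \<int> \<Longrightarrow> g \<in> C0 G \<int> \<Longrightarrow> f - g \<in> C0 G \<int>"
  by (auto simp: C0_def)

lemma subspace_C1: "subspace (C1 G arev UNIV)"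
  by (auto simp: subspace_def C1_def)

lemma Lam_eq_lapl_image: "Lam G A = lapl G ` C0 G A"
  by (simp add: Lam_def Flat_def image_image lapl_def)

lemma Flat_mono: "A \<subseteq> B \<Longrightarrow> Flat G A \<subseteq> Flat G B"
  unfolding Flat_def using C0_mono by blast

lemma zero_in_Flat: "0 \<in> Flat G \<int>"
  unfolding Flat_def by (rule image_eqI[of _ _ 0]) (auto simp: C0_def linear_0[OF linear_cobd])

lemma abs_le_square_Ints:
  fixes a :: real
  assumes "a \<in> \<int>"
  shows "\<bar>a\<bar> \<le> a * a"
proof -
  obtain n :: int where n: "a = of_int n" using assms by (rule Ints_cases)
  have "\<bar>n\<bar> * 1 \<le> \<bar>n\<bar> * \<bar>n\<bar>" by (cases "n = 0") (simp, intro mult_left_mono, auto)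
  then have "\<bar>n\<bar> \<le> n * n" by (simp add: abs_mult_self_eq)
  then show ?thesis unfolding n by (metis of_int_abs of_int_le_iff of_int_mult)
qed

text \<open>The contribution of a single edge to the Voronoi inequality: \<open>a\<close> is the
  value of an integral coboundary, \<open>z\<close> the deviation from the centre of a cube.\<close>

lemma mult_le_half_square_Ints:
  fixes a z :: real
  assumes "a \<in> \<int>" and "\<bar>z\<bar> \<le> 1 / 2"
  shows "2 * (a * z) \<le> a * a"
proof -
  have "2 * (a * z) \<le> 2 * (\<bar>a\<bar> * \<bar>z\<bar>)" by (simp flip: abs_mult)
  also have "\<dots> \<le> \<bar>a\<bar>" using mult_left_mono[OF assms(2), of "\<bar>a\<bar>"] by simp
  also have "\<dots> \<le> a * a" using assms(1) by (rule abs_le_square_Ints)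
  finally show ?thesis .
qed

locale connected_bidirected_digraph = bidirected_digraph G arev
  for G :: "('v::finite, 'e::finite) pre_digraph" and arev :: "'e \<Rightarrow> 'e" +
  assumes connected_graph: "Digraph_Component.connected G"
begin

section \<open>Adjointness, and injectivity and discreteness on coboundaries\<close>

lemma H0_eq: "H0 G = lapl G ` C0 G UNIV"
  using H0_eq_Lam[OF bidirected_digraph_axioms connected_graph] by (simp add: Lam_eq_lapl_image)

lemma inner_cobd_adj:
  assumes "x \<in> C1 G arev UNIV"
  shows "f \<bullet> cobd_adj G x = (cobd G f \<bullet> x) / 2"
proof -
  have "cobd G f \<bullet> x = (\<Sum>e \<in> arcs G. cobd G f $ e * x $ e)"
    unfolding inner_vec_def inner_real_def
    by (rule sum.mono_neutral_right) (auto simp: cobd_def)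
  then show ?thesis
    using cobd_adjoint[OF bidirected_digraph_axioms assms] by simp
qed

lemma inner_lapl_cobd: "f \<bullet> lapl G g = (cobd G f \<bullet> cobd G g) / 2"
  unfolding lapl_def by (rule inner_cobd_adj[OF cobd_in_C1[OF bidirected_digraph_axioms]])

lemma inner_lapl_commute: "f \<bullet> lapl G g = g \<bullet> lapl G f"
  by (simp add: inner_lapl_cobd inner_commute)

lemma Flat_subset_C1: "Flat G A \<subseteq> C1 G arev UNIV"
  unfolding Flat_def using cobd_in_C1[OF bidirected_digraph_axioms] by blast

text \<open>The sum over the vertices is the pairing with the constant function 1, whose coboundary
  vanishes.\<close>

lemma cobd_adj_in_H0:
  assumes x: "x \<in> C1 G arev UNIV"
  shows "cobd_adj G x \<in> H0 G"
proof -
  have C: "cobd_adj G x \<in> C0 G UNIV"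
    by (auto simp: C0_def cobd_adj_def intro!: sum.neutral)
  have "(\<chi> v. 1) \<bullet> cobd_adj G x = (cobd G (\<chi> v. 1) \<bullet> x) / 2"
    by (rule inner_cobd_adj[OF x])
  also have "cobd G (\<chi> v. 1) = 0" by (simp add: cobd_def vec_eq_iff)
  finally have "(\<Sum>v \<in> UNIV. cobd_adj G x $ v) = 0" by (simp add: inner_vec_def)
  moreover have "(\<Sum>v \<in> verts G. cobd_adj G x $ v) = (\<Sum>v \<in> UNIV. cobd_adj G x $ v)"
    using C by (intro sum.mono_neutral_left) (auto simp: C0_def)
  ultimately show ?thesis using C by (simp add: H0_def)
qed

lemma cobd_adj_image_C1: "cobd_adj G ` C1 G arev UNIV = H0 G"
proof
  show "cobd_adj G ` C1 G arev UNIV \<subseteq> H0 G" using cobd_adj_in_H0 by blast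
  show "H0 G \<subseteq> cobd_adj G ` C1 G arev UNIV"
    unfolding H0_eq using cobd_in_C1[OF bidirected_digraph_axioms] by (force simp: lapl_def)
qed

text \<open>For \<open>x = cobd G f\<close>, pairing \<open>cobd_adj G x\<close> with
  \<open>f\<close> gives half the squared norm of \<open>x\<close>.\<close>

lemma cobd_adj_Flat_eq_0:
  assumes "x \<in> Flat G A" and "cobd_adj G x = 0"
  shows "x = 0"
proof -
  obtain f where f: "x = cobd G f" using assms(1) by (auto simp: Flat_def)
  have "f \<bullet> lapl G f = 0" using assms(2) by (simp add: lapl_def f)
  then show ?thesis by (simp add: inner_lapl_cobd f)
qed

lemma subspace_Flat: "subspace (Flat G UNIV)"
  unfolding Flat_def by (rule linear_subspace_image[OF linear_cobd subspace_C0])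

lemma inj_on_cobd_adj_Flat: "inj_on (cobd_adj G) (Flat G UNIV)"
  using linear_injective_on_subspace_0[OF linear_cobd_adj subspace_Flat] cobd_adj_Flat_eq_0
  by blast

lemma Flat_Ints_nth:
  assumes "x \<in> Flat G \<int>"
  shows "x $ e \<in> \<int>"
  using assms by (auto simp: Flat_def cobd_def C0_def)

lemma Flat_Ints_dist_less_1:
  assumes "x \<in> Flat G \<int>" "y \<in> Flat G \<int>" "dist x y < 1"
  shows "x = y"
proof -
  have "x $ e = y $ e" for e
  proof -
    have "\<bar>x $ e - y $ e\<bar> < 1"
      using component_le_norm_cart[of "x - y" e] assms(3) by (simp add: dist_norm)
    moreover have "x $ e - y $ e \<in> \<int>" using Flat_Ints_nth assms by simp
    ultimately show ?thesis using Ints_nonzero_abs_less1 by fastforce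
  qed
  then show ?thesis by (simp add: vec_eq_iff)
qed

section \<open>Voronoi cells of the Laplacian lattice\<close>

text \<open>Write \<open>h = lapl G g\<close>, \<open>u = g - f\<close> and \<phi> for the
  difference between another integral function and \<open>f\<close>. Moving the centre by \<phi>
  changes the quadratic form by \<open>\<phi> \<bullet> lapl G \<phi> - 2 * (\<phi> \<bullet> lapl G
  u)\<close>, where \<open>lapl G u = h - lapl G f\<close>.\<close>

lemma Vor_iff:
  assumes f: "f \<in> C0 G \<int>"
  shows "h \<in> Vor G (lapl G f) \<longleftrightarrow>
    h \<in> H0 G \<and> (\<forall>\<phi> \<in> C0 G \<int>. 2 * (\<phi> \<bullet> (h - lapl G f)) \<le> \<phi> \<bullet> lapl G \<phi>)"
proof (cases "h \<in> H0 G")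
  case True
  then obtain g where g: "g \<in> C0 G UNIV" "h = lapl G g" unfolding H0_eq by blast
  have fU: "f' \<in> C0 G UNIV" if "f' \<in> C0 G \<int>" for f'
    using that C0_mono[of \<int> UNIV] by blast
  have q: "qform G (h - lapl G f') = (g - f') \<bullet> lapl G (g - f')" if "f' \<in> C0 G \<int>" for f'
    using qform_lapl[OF bidirected_digraph_axioms subspace_diff[OF subspace_C0 g(1) fU[OF that]]]
    by (simp add: lapl_diff g(2))
  have *: "qform G (h - lapl G f) \<le> qform G (h - lapl G f') \<longleftrightarrow>
      2 * ((f' - f) \<bullet> (h - lapl G f)) \<le> (f' - f) \<bullet> lapl G (f' - f)" if f': "f' \<in> C0 G \<int>" for f'
  proof -
    define u where "u = g - f"
    have "g - f' = u - (f' - f)" by (simp add: u_def)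
    then have "(g - f') \<bullet> lapl G (g - f') =
        u \<bullet> lapl G u - 2 * ((f' - f) \<bullet> lapl G u) + (f' - f) \<bullet> lapl G (f' - f)"
      using inner_lapl_commute[of u "f' - f"]
      by (simp only: lapl_diff[of G u] inner_diff_left[of u] inner_diff_right[of _ "lapl G u"])
    then show ?thesis
      unfolding q[OF f] q[OF f'] by (simp add: u_def lapl_diff g(2))
  qed
  have "h \<in> Vor G (lapl G f) \<longleftrightarrow>
    (\<forall>f'\<in>C0 G \<int>. 2 * ((f' - f) \<bullet> (h - lapl G f)) \<le> (f' - f) \<bullet> lapl G (f' - f))"
    using True * by (auto simp: Vor_def Lam_eq_lapl_image)
  also have "\<dots> \<longleftrightarrow> (\<forall>\<phi> \<in> C0 G \<int>. 2 * (\<phi> \<bullet> (h - lapl G f)) \<le> \<phi> \<bullet> lapl G \<phi>)"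
  proof (intro iffI ballI)
    fix \<phi> assume "\<forall>f'\<in>C0 G \<int>. 2 * ((f' - f) \<bullet> (h - lapl G f)) \<le> (f' - f) \<bullet> lapl G (f' - f)"
      and \<phi>: "\<phi> \<in> C0 G \<int>"
    moreover have "f + \<phi> \<in> C0 G \<int>" using f \<phi> by (auto simp: C0_def)
    ultimately show "2 * (\<phi> \<bullet> (h - lapl G f)) \<le> \<phi> \<bullet> lapl G \<phi>" by fastforce
  qed (use C0_Ints_diff f in blast)
  finally show ?thesis using True by simp
qed (simp add: Vor_def)

text \<open>Up to the factor 1/2, the quadratic form is the squared Euclidean distance between
  coboundaries. The cell containing \<open>h = lapl G g\<close> is therefore found from an integral
  coboundary nearest to \<open>cobd G g\<close>.\<close>

lemma Vor_cover:
  assumes "h \<in> H0 G"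
  shows "\<exists>\<beta>\<in>Flat G \<int>. h \<in> Vor G (cobd_adj G \<beta>)"
proof -
  obtain g where g: "g \<in> C0 G UNIV" "h = lapl G g" using assms unfolding H0_eq by blast
  have "closed (Flat G \<int>)"
    \<comment> \<open>Discreteness makes the lattice closed, so the minimal distance is
      attained.\<close>
    by (rule discrete_imp_closed[of 1]) (use Flat_Ints_dist_less_1 in auto)
  then obtain \<beta> where \<beta>: "\<beta> \<in> Flat G \<int>"
    and min: "\<And>\<gamma>. \<gamma> \<in> Flat G \<int> \<Longrightarrow> dist (cobd G g) \<beta> \<le> dist (cobd G g) \<gamma>"
    using distance_attains_inf[of "Flat G \<int>" "cobd G g"] zero_in_Flat by blast
  have q: "qform G (h - cobd_adj G \<gamma>) = (dist (cobd G g) \<gamma>)\<^sup>2 / 2" if \<gamma>: "\<gamma> \<in> Flat G \<int>" for \<gamma>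
  proof -
    obtain f where f: "f \<in> C0 G \<int>" "\<gamma> = cobd G f" using \<gamma> by (auto simp: Flat_def)
    have "f \<in> C0 G UNIV" using f(1) C0_mono[of \<int> UNIV] by blast
    then have "qform G (lapl G (g - f)) = (g - f) \<bullet> lapl G (g - f)"
      by (rule qform_lapl[OF bidirected_digraph_axioms subspace_diff[OF subspace_C0 g(1)]])
    moreover have "h - cobd_adj G \<gamma> = lapl G (g - f)"
      unfolding lapl_diff by (simp add: g(2) f(2) lapl_def)
    ultimately show ?thesis
      by (simp add: inner_lapl_cobd f(2) cobd_diff dist_norm power2_norm_eq_inner)
  qed
  have "h \<in> Vor G (cobd_adj G \<beta>)"
    using assms min by (auto simp: Vor_def Lam_def q \<beta> intro!: power_mono)
  then show ?thesis using \<beta> by blast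
qed

section \<open>Cubes as polytopes in the cochain space\<close>

lemma cube_iff:
  assumes "\<beta> \<in> C1 G arev UNIV"
  shows "x \<in> cube G arev \<beta> \<longleftrightarrow> x \<in> C1 G arev UNIV \<and> (\<forall>e. \<bar>x $ e - \<beta> $ e\<bar> \<le> 1 / 2)"
proof -
  have "\<bar>x $ e - \<beta> $ e\<bar> \<le> 1 / 2" if "x \<in> C1 G arev UNIV" "e \<notin> arcs G" for e
    using that assms by (simp add: C1_def)
  then show ?thesis unfolding cube_def by blast
qed

lemma cube_subset_C1: "cube G arev \<beta> \<subseteq> C1 G arev UNIV"
  by (auto simp: cube_def)

lemma polytope_cube:
  assumes "\<beta> \<in> C1 G arev UNIV"
  shows "polytope (cube G arev \<beta>)"
proof -
  have "cube G arev \<beta> = cbox (\<beta> - (\<chi> e. 1 / 2)) (\<beta> + (\<chi> e. 1 / 2)) \<inter> C1 G arev UNIV"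
  proof -
    have "\<bar>a - b\<bar> \<le> 1 / 2 \<longleftrightarrow> b - 1 / 2 \<le> a \<and> a \<le> b + 1 / 2" for a b :: real by arith
    then show ?thesis
      by (auto simp only: set_eq_iff cube_iff[OF assms] mem_box_cart Int_iff
          vector_minus_component vector_add_component vec_lambda_beta)
  qed
  then show ?thesis
    by (simp add: polytope_Int_polyhedron polytope_interval affine_imp_polyhedron
        subspace_imp_affine subspace_C1)
qed

text \<open>The cube contains a ball of \<open>C1 G arev UNIV\<close> about its centre. Hence its
  interior in that space is its relative interior.\<close>

lemma affine_hull_cube:
  assumes \<beta>: "\<beta> \<in> C1 G arev UNIV"
  shows "affine hull (cube G arev \<beta>) = C1 G arev UNIV"
proof
  have aff: "affine hull (C1 G arev UNIV) = C1 G arev UNIV"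
    by (simp add: hull_same subspace_imp_affine subspace_C1)
  show "affine hull (cube G arev \<beta>) \<subseteq> C1 G arev UNIV"
    using hull_mono[OF cube_subset_C1] aff by blast
  have "affine hull (C1 G arev UNIV \<inter> ball \<beta> (1 / 2)) = affine hull (C1 G arev UNIV)"
    by (rule affine_hull_openin) (use \<beta> in \<open>auto simp: aff openin_open\<close>)
  moreover have "C1 G arev UNIV \<inter> ball \<beta> (1 / 2) \<subseteq> cube G arev \<beta>"
  proof
    fix x assume x: "x \<in> C1 G arev UNIV \<inter> ball \<beta> (1 / 2)"
    have "\<bar>x $ e - \<beta> $ e\<bar> \<le> 1 / 2" for e
      using component_le_norm_cart[of "x - \<beta>" e] x by (simp add: dist_norm norm_minus_commute)
    then show "x \<in> cube G arev \<beta>" using x cube_iff[OF \<beta>] by blast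
  qed
  ultimately show "C1 G arev UNIV \<subseteq> affine hull (cube G arev \<beta>)"
    using hull_mono aff by metis
qed

section \<open>Images of cubes and preimages of Voronoi cells\<close>

lemma cobd_adj_cube_subset_Vor:
  assumes \<beta>: "\<beta> \<in> Flat G \<int>" and x: "x \<in> cube G arev \<beta>"
  shows "cobd_adj G x \<in> Vor G (cobd_adj G \<beta>)"
proof -
  obtain f where f: "f \<in> C0 G \<int>" "\<beta> = cobd G f" using \<beta> by (auto simp: Flat_def)
  have \<beta>C: "\<beta> \<in> C1 G arev UNIV" using \<beta> Flat_subset_C1 by blast
  have xC: "x \<in> C1 G arev UNIV" and xb: "\<And>e. \<bar>x $ e - \<beta> $ e\<bar> \<le> 1 / 2"
    using x cube_iff[OF \<beta>C] by auto
  have "2 * (\<phi> \<bullet> (cobd_adj G x - lapl G f)) \<le> \<phi> \<bullet> lapl G \<phi>" if \<phi>: "\<phi> \<in> C0 G \<int>" for \<phi>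
  proof -
    have "cobd G \<phi> $ e \<in> \<int>" for e using \<phi> Flat_Ints_nth by (auto simp: Flat_def)
    \<comment> \<open>The one-edge estimate is summed with \<open>a = cobd G \<phi> $ e\<close> and
      \<open>z = (x - \<beta>) $ e\<close>; adjointness then halves both sides.\<close>
    then have "2 * (cobd G \<phi> \<bullet> (x - \<beta>)) \<le> cobd G \<phi> \<bullet> cobd G \<phi>"
      using xb by (auto simp: inner_vec_def sum_distrib_left intro!: sum_mono mult_le_half_square_Ints)
    moreover have "cobd_adj G x - lapl G f = cobd_adj G (x - \<beta>)"
      by (simp add: lapl_def f(2) cobd_adj_diff)
    ultimately show ?thesis
      by (simp add: inner_lapl_cobd inner_cobd_adj[OF subspace_diff[OF subspace_C1 xC \<beta>C]])
  qed
  then show ?thesis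
    using Vor_iff[OF f(1)] cobd_adj_in_H0[OF xC] by (simp add: lapl_def f(2))
qed

text \<open>Peeling off the top level set of \<open>f\<close> splits the total variation additively, which reduces the
  bound to indicator functions.\<close>

lemma inner_le_total_variation:
  assumes h: "h \<in> H0 G" and cut: "\<And>\<phi>. \<phi> \<in> C0 G \<int> \<Longrightarrow> 2 * (\<phi> \<bullet> h) \<le> \<phi> \<bullet> lapl G \<phi>"
  shows "4 * (f \<bullet> h) \<le> (\<Sum>e\<in>UNIV. \<bar>cobd G f $ e\<bar>)"
proof (induction "card ((\<lambda>v. f $ v) ` verts G)" arbitrary: f rule: less_induct)
  case less
  have inner_h: "g \<bullet> h = (\<Sum>v\<in>verts G. g $ v * h $ v)" for g
    unfolding inner_vec_def inner_real_def
    using h by (intro sum.mono_neutral_right) (auto simp: H0_def C0_def)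
  obtain v0 where v0: "v0 \<in> verts G" using connected_graph unfolding connected_conv by blast
  define I where "I = (\<lambda>v. f $ v) ` verts G"
  define a where "a = Max I"
  have I: "finite I" "I \<noteq> {}" using v0 by (auto simp: I_def)
  have a: "a \<in> I" "\<And>v. v \<in> verts G \<Longrightarrow> f $ v \<le> a"
    using I by (auto simp: a_def I_def)
  show ?case
  proof (cases "I = {a}")
    \<comment> \<open>For constant \<open>f\<close> the left-hand side vanishes, since the values of
      \<open>h\<close> sum to 0.\<close>
    case True
    then have "f $ v = a" if "v \<in> verts G" for v using that by (auto simp: I_def)
    then have "f \<bullet> h = a * (\<Sum>v\<in>verts G. h $ v)" by (simp add: inner_h sum_distrib_left)
    also have "\<dots> = 0" using h by (simp add: H0_def)
    finally show ?thesis by (simp add: sum_nonneg)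
  next
    case False
    \<comment> \<open>\<open>b\<close> is the second largest value of \<open>f\<close>. Lowering the
      top level set to \<open>b\<close> removes the value \<open>a\<close> and creates no new one,
      so the induction applies to \<open>f'\<close>.\<close>
    define b where "b = Max (I - {a})"
    have Ia: "finite (I - {a})" "I - {a} \<noteq> {}" using I False a(1) by auto
    then have "b \<in> I - {a}" unfolding b_def by (rule Max_in)
    then have b: "b \<in> I" "b < a" using a(2) by (auto simp: I_def less_le)
    have le_b: "f $ v \<le> b" if "v \<in> verts G" "f $ v \<noteq> a" for v
      using that Ia by (auto simp: b_def I_def intro!: Max_ge)
    define \<phi> :: "real ^ 'v" where "\<phi> = (\<chi> v. if v \<in> verts G \<and> f $ v = a then 1 else 0)"
    define f' where "f' = f - (a - b) *\<^sub>R \<phi>"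
    have f'_nth: "f' $ v = (if v \<in> verts G \<and> f $ v = a then b else f $ v)" for v
      by (simp add: f'_def \<phi>_def)
    have "(\<lambda>v. f' $ v) ` verts G \<subseteq> I - {a}"
      using b by (auto simp: f'_nth I_def)
    then have "card ((\<lambda>v. f' $ v) ` verts G) < card I"
      using I a(1) by (meson card_Diff1_less card_mono finite_Diff le_less_trans)
    then have IH: "4 * (f' \<bullet> h) \<le> (\<Sum>e\<in>UNIV. \<bar>cobd G f' $ e\<bar>)"
      using less by (simp add: I_def)
    have \<phi>: "\<phi> \<in> C0 G \<int>" by (auto simp: \<phi>_def C0_def)
    \<comment> \<open>The coboundary of an indicator takes values in {-1, 0, 1}, where squares and
      absolute values agree; this turns the quadratic hypothesis into a bound by total
      variation.\<close>
    have "cobd G \<phi> $ e * cobd G \<phi> $ e = \<bar>cobd G \<phi> $ e\<bar>" for e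
      by (auto simp: cobd_def \<phi>_def)
    then have "cobd G \<phi> \<bullet> cobd G \<phi> = (\<Sum>e\<in>UNIV. \<bar>cobd G \<phi> $ e\<bar>)"
      by (simp add: inner_vec_def)
    then have \<phi>_le: "4 * (\<phi> \<bullet> h) \<le> (\<Sum>e\<in>UNIV. \<bar>cobd G \<phi> $ e\<bar>)"
      using cut[OF \<phi>] by (simp add: inner_lapl_cobd)
    \<comment> \<open>No value of \<open>f\<close> lies strictly between \<open>b\<close> and
      \<open>a\<close>, so lowering the top level set never reverses the sign of a jump, and
      absolute values add.\<close>
    have split: "\<bar>cobd G f $ e\<bar> = \<bar>cobd G f' $ e\<bar> + (a - b) * \<bar>cobd G \<phi> $ e\<bar>" for e
    proof (cases "e \<in> arcs G")
      case True
      then have "head G e \<in> verts G" "tail G e \<in> verts G" by auto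
      then show ?thesis
        using True b(2) le_b[of "head G e"] le_b[of "tail G e"]
        by (auto simp: cobd_def f'_nth \<phi>_def)
    qed (simp add: cobd_def)
    have "4 * (f \<bullet> h) = 4 * (f' \<bullet> h) + (a - b) * (4 * (\<phi> \<bullet> h))"
      by (simp add: f'_def inner_diff_left algebra_simps)
    also have "\<dots> \<le> (\<Sum>e\<in>UNIV. \<bar>cobd G f' $ e\<bar>) + (a - b) * (\<Sum>e\<in>UNIV. \<bar>cobd G \<phi> $ e\<bar>)"
      using b(2) by (intro add_mono IH mult_left_mono[OF \<phi>_le]) simp
    also have "\<dots> = (\<Sum>e\<in>UNIV. \<bar>cobd G f $ e\<bar>)"
      by (simp add: split sum.distrib sum_distrib_left)
    finally show ?thesis .
  qed
qed

text \<open>A max-flow min-cut statement: \<open>h\<close> is a demand, the cube about 0 consists of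
  the flows of capacity 1/2, and the hypothesis at indicator functions is the cut condition.\<close>

lemma bounded_flow_exists:
  assumes h: "h \<in> H0 G" and cut: "\<And>\<phi>. \<phi> \<in> C0 G \<int> \<Longrightarrow> 2 * (\<phi> \<bullet> h) \<le> \<phi> \<bullet> lapl G \<phi>"
  shows "h \<in> cobd_adj G ` cube G arev 0"
proof (rule ccontr)
  have 0: "0 \<in> C1 G arev UNIV" using subspace_0[OF subspace_C1] .
  have P: "polytope (cobd_adj G ` cube G arev 0)"
    by (rule polytope_linear_image[OF linear_cobd_adj polytope_cube[OF 0]])
  assume "h \<notin> cobd_adj G ` cube G arev 0"
  then obtain a b where ab: "a \<bullet> h < b" "\<And>z. z \<in> cube G arev 0 \<Longrightarrow> b < a \<bullet> cobd_adj G z"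
    using separating_hyperplane_closed_point[OF polytope_imp_convex[OF P] polytope_imp_closed[OF P]]
    by blast
  \<comment> \<open>This point minimizes the pairing of \<open>a\<close> with
    \<open>cobd_adj G z\<close> over the cube: each edge is used at full capacity against the sign
    of \<open>cobd G a\<close>. The minimum is minus a quarter of the total variation of
    \<open>a\<close>.\<close>
  define z :: "real ^ 'e" where "z = (\<chi> e. - sgn (cobd G a $ e) / 2)"
  have zC: "z \<in> C1 G arev UNIV"
    using cobd_in_C1[OF bidirected_digraph_axioms, of a]
    by (auto simp: z_def C1_def sgn_minus)
  then have "z \<in> cube G arev 0"
    unfolding cube_iff[OF 0] by (auto simp: z_def abs_sgn_eq)
  then have "a \<bullet> h < (cobd G a \<bullet> z) / 2"
    using ab inner_cobd_adj[OF zC, of a] by fastforce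
  also have "cobd G a \<bullet> z = - (\<Sum>e\<in>UNIV. \<bar>cobd G a $ e\<bar>) / 2"
    by (simp add: inner_vec_def z_def sum_negf sum_divide_distrib abs_sgn)
  finally have "(\<Sum>e\<in>UNIV. \<bar>cobd G (- a) $ e\<bar>) < 4 * ((- a) \<bullet> h)"
    by (simp add: linear_neg[OF linear_cobd])
  then show False using inner_le_total_variation[OF h cut, of "- a"] by simp
qed

text \<open>For the harder inclusion, translation by \<beta> reduces to the cube about 0 and the
  existence of a bounded flow.\<close>

lemma cobd_adj_cube:
  assumes \<beta>: "\<beta> \<in> Flat G \<int>"
  shows "cobd_adj G ` cube G arev \<beta> = Vor G (cobd_adj G \<beta>)"
proof
  show "cobd_adj G ` cube G arev \<beta> \<subseteq> Vor G (cobd_adj G \<beta>)"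
    using cobd_adj_cube_subset_Vor[OF \<beta>] by blast
  show "Vor G (cobd_adj G \<beta>) \<subseteq> cobd_adj G ` cube G arev \<beta>"
  proof
    fix h assume h: "h \<in> Vor G (cobd_adj G \<beta>)"
    obtain f where f: "f \<in> C0 G \<int>" "\<beta> = cobd G f" using \<beta> by (auto simp: Flat_def)
    have \<beta>C: "\<beta> \<in> C1 G arev UNIV" using \<beta> Flat_subset_C1 by blast
    have hV: "h \<in> H0 G" "\<And>\<phi>. \<phi> \<in> C0 G \<int> \<Longrightarrow> 2 * (\<phi> \<bullet> (h - cobd_adj G \<beta>)) \<le> \<phi> \<bullet> lapl G \<phi>"
      using h Vor_iff[OF f(1), of h] by (auto simp: f(2) lapl_def)
    have "h - cobd_adj G \<beta> \<in> H0 G"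
      using subspace_diff[OF subspace_H0 hV(1) cobd_adj_in_H0[OF \<beta>C]] .
    then obtain z where z: "z \<in> cube G arev 0" "h - cobd_adj G \<beta> = cobd_adj G z"
      using bounded_flow_exists hV(2) by blast
    have "z + \<beta> \<in> cube G arev \<beta>"
      using z(1) subspace_add[OF subspace_C1 _ \<beta>C, of z] by (auto simp: cube_def)
    moreover have "cobd_adj G (z + \<beta>) = h"
      by (simp add: linear_add[OF linear_cobd_adj] flip: z(2))
    ultimately show "h \<in> cobd_adj G ` cube G arev \<beta>" by blast
  qed
qed

lemma mem_cube_of_cobd_adj_mem_Vor:
  assumes \<beta>: "\<beta> \<in> Flat G \<int>" and x: "x \<in> cubes G arev" and V: "cobd_adj G x \<in> Vor G (cobd_adj G \<beta>)"
  shows "x \<in> cube G arev \<beta>"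
proof -
  obtain \<gamma> where \<gamma>: "\<gamma> \<in> Flat G \<int>" "x \<in> cube G arev \<gamma>" using x by (auto simp: cubes_def)
  obtain f where f: "f \<in> C0 G \<int>" "\<beta> = cobd G f" using \<beta> by (auto simp: Flat_def)
  obtain g where g: "g \<in> C0 G \<int>" "\<gamma> = cobd G g" using \<gamma>(1) by (auto simp: Flat_def)
  have \<beta>C: "\<beta> \<in> C1 G arev UNIV" and \<gamma>C: "\<gamma> \<in> C1 G arev UNIV"
    using \<beta> \<gamma>(1) Flat_subset_C1 by blast+
  have xC: "x \<in> C1 G arev UNIV" and xb: "\<And>e. \<bar>x $ e - \<gamma> $ e\<bar> \<le> 1 / 2"
    using \<gamma>(2) cube_iff[OF \<gamma>C] by auto
  define a where "a = \<beta> - \<gamma>"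
  define z where "z = x - \<gamma>"
  have a_Ints: "a $ e \<in> \<int>" for e using \<beta> \<gamma>(1) Flat_Ints_nth by (simp add: a_def)
  \<comment> \<open>The inequality for the cell of \<beta> is tested in the direction of the other
    centre \<gamma>.\<close>
  have "2 * ((g - f) \<bullet> cobd_adj G (x - \<beta>)) \<le> (g - f) \<bullet> lapl G (g - f)"
    using V Vor_iff[OF f(1), of "cobd_adj G x"] C0_Ints_diff[OF g(1) f(1)]
    by (simp add: lapl_def f(2) cobd_adj_diff)
  then have "2 * ((- a) \<bullet> (z - a)) \<le> (- a) \<bullet> (- a)"
    unfolding inner_lapl_cobd inner_cobd_adj[OF subspace_diff[OF subspace_C1 xC \<beta>C]]
    by (simp add: cobd_diff a_def z_def f(2) g(2))
  then have "a \<bullet> a \<le> 2 * (a \<bullet> z)" by (simp add: inner_diff_right)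
  then have sum: "(\<Sum>e\<in>UNIV. a $ e * a $ e - 2 * (a $ e * z $ e)) \<le> 0"
    by (simp add: inner_vec_def sum_subtractf sum_distrib_left)
  have nonneg: "0 \<le> a $ e * a $ e - 2 * (a $ e * z $ e)" for e
    using mult_le_half_square_Ints[OF a_Ints] xb by (simp add: z_def)
  have "(\<Sum>e\<in>UNIV. a $ e * a $ e - 2 * (a $ e * z $ e)) = 0"
    by (intro antisym sum sum_nonneg nonneg)
  then have eq: "a $ e * a $ e - 2 * (a $ e * z $ e) = 0" for e
    using nonneg by (simp add: sum_nonneg_eq_0_iff)
  have "\<bar>x $ e - \<beta> $ e\<bar> \<le> 1 / 2" for e
  proof -
    \<comment> \<open>Equality on every edge leaves \<open>a = 0\<close> or
      \<open>a = 2 * z\<close>; then \<open>z - a\<close> is \<open>z\<close> or \<open>- z\<close>,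
      so \<open>x\<close> deviates equally from both centres.\<close>
    have "a $ e * (a $ e - 2 * z $ e) = 0" using eq[of e] by (simp add: algebra_simps)
    then have "a $ e = 0 \<or> a $ e = 2 * z $ e" by simp
    then have "\<bar>z $ e - a $ e\<bar> = \<bar>z $ e\<bar>" by auto
    then show ?thesis using xb[of e] by (simp add: a_def z_def)
  qed
  then show ?thesis using xC cube_iff[OF \<beta>C] by blast
qed

lemma vimage_Vor_Int_cubes:
  assumes "\<beta> \<in> Flat G \<int>"
  shows "cobd_adj G -` Vor G (cobd_adj G \<beta>) \<inter> cubes G arev = cube G arev \<beta>"
  using assms mem_cube_of_cobd_adj_mem_Vor[OF assms] cobd_adj_cube_subset_Vor[OF assms]
  by (auto simp: cubes_def)

text \<open>The affine hulls of the cube and of the cell are the two ambient spaces, so both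
  interiors are relative interiors, and these commute with linear images of convex sets.\<close>

lemma cobd_adj_interior_cube:
  assumes \<beta>: "\<beta> \<in> Flat G \<int>"
  shows "cobd_adj G ` (top_of_set (C1 G arev UNIV) interior_of cube G arev \<beta>) =
    top_of_set (H0 G) interior_of Vor G (cobd_adj G \<beta>)"
proof -
  have \<beta>C: "\<beta> \<in> C1 G arev UNIV" using \<beta> Flat_subset_C1 by blast
  have rel: "top_of_set (affine hull S) interior_of S = rel_interior S" for S :: "(real ^ 'n::finite) set"
    unfolding interior_of_def rel_interior_def by blast
  have "affine hull (Vor G (cobd_adj G \<beta>)) = H0 G"
    using affine_hull_linear_image[of "cobd_adj G" "cube G arev \<beta>"] linear_cobd_adj[of G]
    by (simp add: linear_conv_bounded_linear affine_hull_cube[OF \<beta>C] cobd_adj_cube[OF \<beta>]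
        cobd_adj_image_C1)
  then have "top_of_set (H0 G) interior_of Vor G (cobd_adj G \<beta>) =
      rel_interior (cobd_adj G ` cube G arev \<beta>)"
    using rel[of "Vor G (cobd_adj G \<beta>)"] by (simp add: cobd_adj_cube[OF \<beta>])
  also have "\<dots> = cobd_adj G ` rel_interior (cube G arev \<beta>)"
    by (rule rel_interior_convex_linear_image[symmetric, OF linear_cobd_adj
          polytope_imp_convex[OF polytope_cube[OF \<beta>C]]])
  finally show ?thesis using rel[of "cube G arev \<beta>"] by (simp add: affine_hull_cube[OF \<beta>C])
qed

section \<open>Fibers and contractibility\<close>

lemma fiber_eq:
  assumes "\<beta> \<in> Flat G \<int>" and "h \<in> Vor G (cobd_adj G \<beta>)"
  shows "{x \<in> cubes G arev. cobd_adj G x = h} = {x \<in> cube G arev \<beta>. cobd_adj G x = h}"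
  using vimage_Vor_Int_cubes[OF assms(1)] assms(2) by auto

lemma fiber_nonempty_compact_convex:
  assumes "h \<in> H0 G"
  shows "{x \<in> cubes G arev. cobd_adj G x = h} \<noteq> {}"
    and "compact {x \<in> cubes G arev. cobd_adj G x = h}"
    and "convex {x \<in> cubes G arev. cobd_adj G x = h}"
proof -
  obtain \<beta> where \<beta>: "\<beta> \<in> Flat G \<int>" "h \<in> Vor G (cobd_adj G \<beta>)" using Vor_cover[OF assms] by blast
  have P: "polytope (cube G arev \<beta>)" using \<beta>(1) Flat_subset_C1 by (blast intro: polytope_cube)
  show "{x \<in> cubes G arev. cobd_adj G x = h} \<noteq> {}"
    using \<beta>(2) unfolding fiber_eq[OF \<beta>] cobd_adj_cube[OF \<beta>(1), symmetric] by blast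
  show "compact {x \<in> cubes G arev. cobd_adj G x = h}"
    unfolding fiber_eq[OF \<beta>] by (rule compact_linear_fiber[OF polytope_imp_compact[OF P] linear_cobd_adj])
  show "convex {x \<in> cubes G arev. cobd_adj G x = h}"
    unfolding fiber_eq[OF \<beta>] by (rule convex_linear_fiber[OF polytope_imp_convex[OF P] linear_cobd_adj])
qed

text \<open>Local finiteness of the Voronoi decomposition. The cells are translates of one bounded
  set, so their centres \<open>cobd_adj G \<beta>\<close> stay bounded. Injectivity of
  \<open>cobd_adj\<close> on the real coboundaries bounds \<beta> itself, and a bounded uniformly
  discrete set is finite.\<close>

lemma finite_Vor_meeting_bounded:
  assumes "bounded B"
  shows "finite {\<beta> \<in> Flat G \<int>. Vor G (cobd_adj G \<beta>) \<inter> B \<noteq> {}}" (is "finite ?S")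
proof -
  have 0: "0 \<in> C1 G arev UNIV" using subspace_0[OF subspace_C1] .
  have "bounded (cobd_adj G ` cube G arev 0)"
    by (rule polytope_imp_bounded[OF polytope_linear_image[OF linear_cobd_adj polytope_cube[OF 0]]])
  then obtain C where C: "\<And>z. z \<in> cube G arev 0 \<Longrightarrow> norm (cobd_adj G z) \<le> C"
    unfolding bounded_iff by blast
  obtain R where R: "\<And>h. h \<in> B \<Longrightarrow> norm h \<le> R" using assms unfolding bounded_iff by blast
  obtain c where c: "c > 0" "\<And>x. x \<in> Flat G UNIV \<Longrightarrow> c * norm x \<le> norm (cobd_adj G x)"
    using injective_imp_isometric[OF closed_subspace[OF subspace_Flat] subspace_Flat, of "cobd_adj G"]
      cobd_adj_Flat_eq_0 linear_cobd_adj by (metis linear_conv_bounded_linear)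
  have "norm \<beta> \<le> (R + C) / c" if \<beta>: "\<beta> \<in> ?S" for \<beta>
  proof -
    obtain h where h: "\<beta> \<in> Flat G \<int>" "h \<in> Vor G (cobd_adj G \<beta>)" "h \<in> B" using \<beta> by blast
    then obtain x where x: "x \<in> cube G arev \<beta>" "h = cobd_adj G x" using cobd_adj_cube by blast
    have \<beta>C: "\<beta> \<in> C1 G arev UNIV" using h(1) Flat_subset_C1 by blast
    have "x - \<beta> \<in> cube G arev 0"
      using x(1) subspace_diff[OF subspace_C1 _ \<beta>C, of x] by (auto simp: cube_def)
    then have "norm (h - cobd_adj G \<beta>) \<le> C" using C by (simp add: x(2) flip: cobd_adj_diff)
    then have "norm (cobd_adj G \<beta>) \<le> R + C"
      using R[OF h(3)] norm_triangle_ineq2[of "cobd_adj G \<beta>" h] by (simp add: norm_minus_commute)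
    moreover have "c * norm \<beta> \<le> norm (cobd_adj G \<beta>)" using c(2) h(1) Flat_mono[of \<int> UNIV] by blast
    ultimately show ?thesis using c(1) by (simp add: pos_le_divide_eq mult.commute)
  qed
  then have "bounded ?S" unfolding bounded_iff by blast
  moreover have "uniform_discrete ?S"
    unfolding uniform_discrete_def by (rule exI[of _ 1]) (use Flat_Ints_dist_less_1 in auto)
  ultimately show ?thesis using uniform_discrete_finite_iff by blast
qed

text \<open>The closest point is taken in the fiber of the whole union, so the definition makes no
  choice of a cell. On each cell this fiber is a slice of one cube, where continuity is known; the
  closed cells form a locally finite cover, so the pieces paste.\<close>

lemma continuous_section:
  obtains s where "continuous_on (H0 G) s"
    and "\<And>h. h \<in> H0 G \<Longrightarrow> s h \<in> cubes G arev \<and> cobd_adj G (s h) = h"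
proof
  define s where "s h = closest_point {x \<in> cubes G arev. cobd_adj G x = h} 0" for h
  show "s h \<in> cubes G arev \<and> cobd_adj G (s h) = h" if "h \<in> H0 G" for h
    using closest_point_in_set[OF compact_imp_closed[OF fiber_nonempty_compact_convex(2)[OF that]] fiber_nonempty_compact_convex(1)[OF that]]
    unfolding s_def by blast
  have "continuous_map (top_of_set (H0 G)) euclidean s"
  proof (rule pasting_lemma_locally_finite[where I = "Flat G \<int>" and f = "\<lambda>_. s"
        and T = "\<lambda>\<beta>. Vor G (cobd_adj G \<beta>)"])
    fix h assume "h \<in> topspace (top_of_set (H0 G))"
    then show "\<exists>V. openin (top_of_set (H0 G)) V \<and> h \<in> V \<and>
        finite {\<beta> \<in> Flat G \<int>. Vor G (cobd_adj G \<beta>) \<inter> V \<noteq> {}}"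
      by (intro exI[of _ "H0 G \<inter> ball h 1"] conjI finite_Vor_meeting_bounded)
        (auto simp: openin_open intro: bounded_subset[OF bounded_ball])
  next
    fix \<beta> assume \<beta>: "\<beta> \<in> Flat G \<int>"
    have P: "polytope (cube G arev \<beta>)" using \<beta> Flat_subset_C1 by (blast intro: polytope_cube)
    have sub: "Vor G (cobd_adj G \<beta>) \<subseteq> H0 G" by (auto simp: Vor_def)
    have "closed (Vor G (cobd_adj G \<beta>))"
      using polytope_imp_closed[OF polytope_linear_image[OF linear_cobd_adj[of G] P]]
      by (simp add: cobd_adj_cube[OF \<beta>])
    then show "closedin (top_of_set (H0 G)) (Vor G (cobd_adj G \<beta>))"
      using sub by (rule_tac closed_subset)
    have "continuous_on (Vor G (cobd_adj G \<beta>)) s"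
      using continuous_on_closest_point_fiber[OF P linear_cobd_adj, of G 0]
      unfolding cobd_adj_cube[OF \<beta>]
      by (rule continuous_on_eq) (simp add: s_def fiber_eq[OF \<beta>])
    then show "continuous_map (subtopology (top_of_set (H0 G)) (Vor G (cobd_adj G \<beta>))) euclidean s"
      using sub by (simp add: subtopology_subtopology inf.absorb2)
  qed (use Vor_cover in auto)
  then show "continuous_on (H0 G) s" by simp
qed

section \<open>Contractibility of the union of cubes\<close>

lemma cubes_subset_C1: "cubes G arev \<subseteq> C1 G arev UNIV"
  using cube_subset_C1 by (auto simp: cubes_def)

lemma contractible_cubes: "contractible (cubes G arev)"
proof -
  obtain s where s: "continuous_on (H0 G) s"
    "\<And>h. h \<in> H0 G \<Longrightarrow> s h \<in> cubes G arev \<and> cobd_adj G (s h) = h"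
    using continuous_section by blast
  let ?X = "cubes G arev"
  have im: "cobd_adj G x \<in> H0 G" if "x \<in> ?X" for x
    using that cubes_subset_C1 cobd_adj_in_H0 by blast
  have cont: "continuous_on ?X (cobd_adj G)"
    using linear_cobd_adj[of G] by (simp add: linear_continuous_on linear_conv_bounded_linear)
  \<comment> \<open>\<open>s \<circ> cobd_adj G\<close> factors through the convex space
    \<open>H0 G\<close>, hence is null-homotopic.\<close>
  obtain c where c: "homotopic_with_canon (\<lambda>h. True) ?X ?X (s \<circ> cobd_adj G) (\<lambda>x. c)"
    using nullhomotopic_through_contractible[OF cont _ s(1) _
        convex_imp_contractible[OF subspace_imp_convex[OF subspace_H0]], of ?X]
      im s(2) by blast
  \<comment> \<open>The straight-line homotopy stays in the union of cubes: its endpoints lie in one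
    fiber, which is convex.\<close>
  have "homotopic_with_canon (\<lambda>h. True) ?X ?X id (s \<circ> cobd_adj G)"
  proof (rule homotopic_with_linear)
    show "continuous_on ?X (s \<circ> cobd_adj G)"
      using cont s(1) im by (intro continuous_on_compose) (auto intro: continuous_on_subset)
    fix x assume x: "x \<in> ?X"
    let ?F = "{y \<in> ?X. cobd_adj G y = cobd_adj G x}"
    have "closed_segment x (s (cobd_adj G x)) \<subseteq> ?F"
      using fiber_nonempty_compact_convex(3)[OF im[OF x]] x s(2)[OF im[OF x]] by (intro closed_segment_subset) auto
    then show "closed_segment (id x) ((s \<circ> cobd_adj G) x) \<subseteq> ?X" by auto
  qed (simp add: continuous_on_id)
  then show ?thesis
    unfolding contractible_def using c homotopic_with_trans by blast
qed

section \<open>Isomorphism of the dual complexes, induced by \<open>cobd_adj\<close>\<close>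

lemma dual_complex_isomorphic:
  "complex_isomorphic (Flat G \<int>) (dual_complex (Flat G \<int>) (cube G arev))
    (Lam G \<int>) (dual_complex (Lam G \<int>) (Vor G))"
  unfolding complex_isomorphic_def
proof (intro exI conjI allI impI)
  have inj: "inj_on (cobd_adj G) (Flat G \<int>)"
    using inj_on_cobd_adj_Flat Flat_mono[of \<int> UNIV] by (blast intro: inj_on_subset)
  then show "bij_betw (cobd_adj G) (Flat G \<int>) (Lam G \<int>)"
    by (simp add: bij_betw_def Lam_def)
  fix S assume S: "S \<subseteq> Flat G \<int>"
  have "finite (cobd_adj G ` S) \<longleftrightarrow> finite S"
    by (rule finite_image_iff[OF inj_on_subset[OF inj S]])
  moreover have "cobd_adj G ` S \<subseteq> Lam G \<int>" using S by (auto simp: Lam_def)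
  moreover have "(\<Inter>\<beta>\<in>S. cube G arev \<beta>) \<noteq> {} \<longleftrightarrow> (\<Inter>l\<in>cobd_adj G ` S. Vor G l) \<noteq> {}"
  proof
    assume "(\<Inter>\<beta>\<in>S. cube G arev \<beta>) \<noteq> {}"
    then obtain x where "\<And>\<beta>. \<beta> \<in> S \<Longrightarrow> x \<in> cube G arev \<beta>" by blast
    then have "cobd_adj G x \<in> (\<Inter>l\<in>cobd_adj G ` S. Vor G l)"
      using S cobd_adj_cube_subset_Vor by blast
    then show "(\<Inter>l\<in>cobd_adj G ` S. Vor G l) \<noteq> {}" by blast
  next
    assume "(\<Inter>l\<in>cobd_adj G ` S. Vor G l) \<noteq> {}"
    then obtain h where h: "\<And>\<beta>. \<beta> \<in> S \<Longrightarrow> h \<in> Vor G (cobd_adj G \<beta>)" by blast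
    show "(\<Inter>\<beta>\<in>S. cube G arev \<beta>) \<noteq> {}"
    \<comment> \<open>An empty intersection is the whole type, so \<open>h\<close> is known to lie
      in \<open>H0 G\<close> only for nonempty \<open>S\<close>.\<close>
    proof (cases "S = {}")
      case False
      then obtain \<beta> where "\<beta> \<in> S" by blast
      then have "h \<in> H0 G" using h by (auto simp: Vor_def)
      then obtain x where "x \<in> cubes G arev" "cobd_adj G x = h" using fiber_nonempty_compact_convex(1) by blast
      \<comment> \<open>One preimage serves all \<beta> in \<open>S\<close> at once: a point of the
        union mapped into the cell of \<beta> lies in the cube of \<beta>.\<close>
      then have "x \<in> (\<Inter>\<beta>\<in>S. cube G arev \<beta>)"
        using h S mem_cube_of_cobd_adj_mem_Vor by blast
      then show ?thesis by blast
    qed simp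
  qed
  ultimately show "S \<in> dual_complex (Flat G \<int>) (cube G arev) \<longleftrightarrow>
      cobd_adj G ` S \<in> dual_complex (Lam G \<int>) (Vor G)"
    using S by (simp add: dual_complex_def)
qed

end

theorem theorem3p14:
  fixes G :: "('v::finite, 'e::finite) pre_digraph" and arev :: "'e \<Rightarrow> 'e"
  assumes "bidirected_digraph G arev"
    and "loopfree_digraph G"
    and "Digraph_Component.connected G"
  shows
    "(\<forall>\<beta> \<in> Flat G \<int>.
        linear (cobd_adj G) \<and>
        cobd_adj G ` cube G arev \<beta> = Vor G (cobd_adj G \<beta>) \<and>
        cobd_adj G ` (top_of_set (C1 G arev UNIV) interior_of cube G arev \<beta>) =
          top_of_set (H0 G) interior_of Vor G (cobd_adj G \<beta>)) \<and>
     (\<forall>\<beta> \<in> Flat G \<int>.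
        cobd_adj G -` Vor G (cobd_adj G \<beta>) \<inter> cubes G arev = cube G arev \<beta>) \<and>
     ((\<forall>h \<in> Lam G UNIV.
         {x \<in> cubes G arev. cobd_adj G x = h} \<noteq> {} \<and>
         compact {x \<in> cubes G arev. cobd_adj G x = h} \<and>
         contractible {x \<in> cubes G arev. cobd_adj G x = h}) \<and>
      cubes G arev \<noteq> {} \<and> contractible (cubes G arev)) \<and>
     complex_isomorphic
       (Flat G \<int>) (dual_complex (Flat G \<int>) (cube G arev))
       (Lam G \<int>) (dual_complex (Lam G \<int>) (Vor G))"
proof -
  interpret connected_bidirected_digraph G arev
    using assms(1,3)
    by (simp add: connected_bidirected_digraph_def connected_bidirected_digraph_axioms_def)
  have Lam: "Lam G UNIV = H0 G" using H0_eq_Lam[OF assms(1,3)] by simp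
  \<comment> \<open>\<open>contractible\<close> also holds of the empty set, so nonemptiness is a
    claim of its own; the fiber over 0 provides a point.\<close>
  have "cubes G arev \<noteq> {}" using fiber_nonempty_compact_convex(1)[OF subspace_0[OF subspace_H0]] by blast
  then show ?thesis
    unfolding Lam
    by (intro conjI ballI linear_cobd_adj cobd_adj_cube cobd_adj_interior_cube vimage_Vor_Int_cubes
        fiber_nonempty_compact_convex convex_imp_contractible contractible_cubes dual_complex_isomorphic)
qed

end
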